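(* Let $X$ be a nonzero real Banach lattice. Then $\lambda^+(X)>1$ if and only if $\varepsilon_{0,m}(X)<1$.
   Context: For a Banach lattice $X$, $S_X^+$ denotes the set of elements $x\in X$ with $x\ge 0$ and $\|x\|=1$. The lattice Schäffer constant is $\lambda^+(X)=\inf\{\max\{\|x-y\|,\|x+y\|\} : x,y\in S_X^+\}$. The lower modulus of uniform monotonicity of $X$ is $\delta_{m,X}(\varepsilon)=\inf\{1-\|x-y\| : 0\le y\le x,\ \|x\|\le 1,\ \|y\|\ge\varepsilon\}$ for $\varepsilon\in[0,1]$, and $\varepsilon_{0,m}(X)=\sup\{\varepsilon\in[0,1) : \delta_{m,X}(\varepsilon)=0\}$. *)

theory Defs
  imports "HOL-Analysis.Analysis" "HOL-Library.Lattice_Algebras"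
begin

text \<open>A real Banach lattice: a real Banach space that is also a vector lattice and whose norm
  is a lattice norm. Here \<open>\<bar>x\<bar>\<close> is the lattice modulus \<open>sup x (- x)\<close>, by the axiom
  \<open>abs_lattice\<close> of the class \<open>lattice_ab_group_add_abs\<close>.\<close>

class banach_lattice = banach + ordered_real_vector + lattice_ab_group_add_abs +
  assumes norm_lattice: "\<bar>x\<bar> \<le> \<bar>y\<bar> \<Longrightarrow> norm x \<le> norm y"

instance real :: banach_lattice
  by standard simp

definition pos_sphere :: "'a::banach_lattice set" where
  "pos_sphere = {x. 0 \<le> x \<and> norm x = 1}"

text \<open>The space is passed as a type argument. For a nonzero space all infima and suprema below are
  over nonempty bounded sets of reals (for the modulus, provided \<open>\<epsilon> \<le> 1\<close>); on the zero space
  they carry no meaning.\<close>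

definition lattice_schaeffer_const :: "'a::banach_lattice itself \<Rightarrow> real" where
  "lattice_schaeffer_const _ =
     Inf {max (norm (x - y)) (norm (x + y)) | x y :: 'a. x \<in> pos_sphere \<and> y \<in> pos_sphere}"

definition lower_modulus_mono :: "'a::banach_lattice itself \<Rightarrow> real \<Rightarrow> real" where
  "lower_modulus_mono _ \<epsilon> =
     Inf {1 - norm (x - y) | x y :: 'a. 0 \<le> y \<and> y \<le> x \<and> norm x \<le> 1 \<and> \<epsilon> \<le> norm y}"

definition eps0_mono :: "'a::banach_lattice itself \<Rightarrow> real" where
  "eps0_mono X = Sup {\<epsilon>. 0 \<le> \<epsilon> \<and> \<epsilon> < 1 \<and> lower_modulus_mono X \<epsilon> = 0}"

end

theory Submission
  imports Defs
begin

text \<open>Both conditions say that a positive vector of the unit ball cannot be cut into two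
  positive parts that are both almost of norm one. Write such a vector as \<open>x = y + (x - y)\<close> with \<open>0 \<le> y \<le> x\<close>, and call the cut \<open>c\<close>-large if both parts have norm at
  least \<open>c\<close>. For positive vectors \<open>\<bar>x - y\<bar> \<le> x + y\<close>, so the maximum that
  defines the Schaeffer constant is simply \<open>norm (x + y)\<close>. A \<open>c\<close>-large cut, with its two parts
  normalised, yields positive unit vectors whose sum lies below \<open>x / c\<close>; conversely positive unit
  vectors with \<open>norm (u + v) \<le> 1 / c\<close>, scaled by \<open>c\<close>, are the parts of a \<open>c\<close>-large cut
  (\<open>large_cut_iff\<close>). Hence the Schaeffer constant exceeds \<open>1\<close> iff \<open>c\<close>-large cuts fail to exist for
  some \<open>c < 1\<close>. The modulus of monotonicity vanishes at \<open>\<epsilon>\<close> iff there are cuts with one part of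
  norm at least \<open>\<epsilon>\<close> and the other of norm arbitrarily close to \<open>1\<close>; comparing with \<open>c\<close>-large cuts,
  its vanishing for \<open>\<epsilon>\<close> arbitrarily close to \<open>1\<close> is again the existence of \<open>c\<close>-large cuts for all
  \<open>c < 1\<close>.\<close>

definition has_large_cut :: "'a::banach_lattice itself \<Rightarrow> real \<Rightarrow> bool" where
  "has_large_cut _ c \<longleftrightarrow>
     (\<exists>x y :: 'a. 0 \<le> y \<and> y \<le> x \<and> norm x \<le> 1 \<and> c \<le> norm y \<and> c \<le> norm (x - y))"

lemma norm_mono_nonneg:
  fixes x y :: "'a::banach_lattice"
  assumes "0 \<le> x" "x \<le> y"
  shows "norm x \<le> norm y"
  using assms by (intro norm_lattice) (auto simp: abs_of_nonneg)

lemma norm_diff_le_norm_add: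
  fixes x y :: "'a::banach_lattice"
  assumes "0 \<le> x" "0 \<le> y"
  shows "norm (x - y) \<le> norm (x + y)"
proof (rule norm_lattice)
  have "x - y \<le> x + y" "- (x - y) \<le> x + y"
    using assms by (auto simp: algebra_simps intro: add_increasing add_increasing2)
  then have "\<bar>x - y\<bar> \<le> x + y" by (rule abs_leI)
  then show "\<bar>x - y\<bar> \<le> \<bar>x + y\<bar>" using assms by (simp add: abs_of_nonneg)
qed

lemma normalize_in_pos_sphere:
  fixes x :: "'a::banach_lattice"
  assumes "0 \<le> x" "x \<noteq> 0"
  shows "x /\<^sub>R norm x \<in> pos_sphere"
  using assms by (simp add: pos_sphere_def scaleR_nonneg_nonneg)

lemma pos_sphere_nonempty:
  assumes "\<exists>x :: 'a::banach_lattice. x \<noteq> 0"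
  shows "\<exists>u :: 'a. u \<in> pos_sphere"
proof -
  obtain x :: 'a where "x \<noteq> 0" using assms by blast
  then have "\<bar>x\<bar> \<noteq> 0" by simp
  then show ?thesis using normalize_in_pos_sphere[of "\<bar>x\<bar>"] by auto
qed

text \<open>Both parts of a \<open>c\<close>-large cut of \<open>x\<close> grow by a factor of at most \<open>1 / c\<close> when they are
  normalised, so the sum of the unit vectors stays below \<open>x / c\<close>. In the other direction, \<open>c\<close> is
  the factor that brings \<open>u + v\<close> back into the unit ball.\<close>

lemma large_cut_iff:
  assumes "0 < c"
  shows "has_large_cut TYPE('a::banach_lattice) c \<longleftrightarrow>
    (\<exists>u v :: 'a. u \<in> pos_sphere \<and> v \<in> pos_sphere \<and> norm (u + v) \<le> 1 / c)"
proof
  assume "has_large_cut TYPE('a) c"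
  then obtain x y :: 'a where xy: "0 \<le> y" "y \<le> x" "norm x \<le> 1" "c \<le> norm y" "c \<le> norm (x - y)"
    unfolding has_large_cut_def by blast
  define u where "u = y /\<^sub>R norm y"
  define v where "v = (x - y) /\<^sub>R norm (x - y)"
  have sphere: "u \<in> pos_sphere" "v \<in> pos_sphere"
    unfolding u_def v_def using xy assms by (auto intro!: normalize_in_pos_sphere)
  have "u \<le> y /\<^sub>R c" "v \<le> (x - y) /\<^sub>R c"
    unfolding u_def v_def using xy assms by (auto intro!: scaleR_right_mono le_imp_inverse_le)
  then have "u + v \<le> y /\<^sub>R c + (x - y) /\<^sub>R c" by (rule add_mono)
  then have "u + v \<le> x /\<^sub>R c" by (simp add: scaleR_right_diff_distrib)
  then have "norm (u + v) \<le> norm (x /\<^sub>R c)"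
    using sphere by (intro norm_mono_nonneg) (auto simp: pos_sphere_def)
  also have "\<dots> \<le> 1 / c"
    using xy assms by (simp add: field_simps)
  finally show "\<exists>u v :: 'a. u \<in> pos_sphere \<and> v \<in> pos_sphere \<and> norm (u + v) \<le> 1 / c"
    using sphere by blast
next
  assume "\<exists>u v :: 'a. u \<in> pos_sphere \<and> v \<in> pos_sphere \<and> norm (u + v) \<le> 1 / c"
  then obtain u v :: 'a where uv: "0 \<le> u" "norm u = 1" "0 \<le> v" "norm v = 1" "norm (u + v) \<le> 1 / c"
    by (auto simp: pos_sphere_def)
  have "0 \<le> c *\<^sub>R u" "0 \<le> c *\<^sub>R v" using uv assms by (simp_all add: scaleR_nonneg_nonneg)
  moreover have "norm (c *\<^sub>R u + c *\<^sub>R v) \<le> 1"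
    using uv assms norm_scaleR[of c "u + v"] by (simp add: scaleR_add_right field_simps)
  ultimately show "has_large_cut TYPE('a) c"
    unfolding has_large_cut_def using uv assms
    by (intro exI[of _ "c *\<^sub>R u + c *\<^sub>R v"] exI[of _ "c *\<^sub>R u"]) simp
qed

lemma schaeffer_const_eq_Inf_norm_add:
  "lattice_schaeffer_const TYPE('a::banach_lattice) =
     Inf {norm (x + y) | x y :: 'a. x \<in> pos_sphere \<and> y \<in> pos_sphere}"
proof -
  have "max (norm (x - y)) (norm (x + y)) = norm (x + y)"
    if "x \<in> pos_sphere" "y \<in> pos_sphere" for x y :: 'a
    using that norm_diff_le_norm_add[of x y] by (auto simp: pos_sphere_def)
  then have "{max (norm (x - y)) (norm (x + y)) | x y :: 'a. x \<in> pos_sphere \<and> y \<in> pos_sphere}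
      = {norm (x + y) | x y :: 'a. x \<in> pos_sphere \<and> y \<in> pos_sphere}"
    by (metis (no_types, lifting))
  then show ?thesis unfolding lattice_schaeffer_const_def by simp
qed

lemma schaeffer_const_gt_1_iff:
  assumes "\<exists>x :: 'a::banach_lattice. x \<noteq> 0"
  shows "lattice_schaeffer_const TYPE('a) > 1 \<longleftrightarrow>
    (\<exists>c. 0 < c \<and> c < 1 \<and> \<not> has_large_cut TYPE('a) c)"
proof -
  define S where "S = {norm (x + y) | x y :: 'a. x \<in> pos_sphere \<and> y \<in> pos_sphere}"
  have eq: "lattice_schaeffer_const TYPE('a) = Inf S"
    unfolding S_def by (rule schaeffer_const_eq_Inf_norm_add)
  have ne: "S \<noteq> {}" using pos_sphere_nonempty[OF assms] by (auto simp: S_def)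
  have bdd: "bdd_below S" by (intro bdd_belowI[of _ 0]) (auto simp: S_def)
  have cut: "has_large_cut TYPE('a) c \<longleftrightarrow> (\<exists>s\<in>S. s \<le> 1 / c)" if "0 < c" for c
    unfolding large_cut_iff[OF that] S_def by blast
  show ?thesis
  proof
    assume "lattice_schaeffer_const TYPE('a) > 1"
    then obtain t where t: "1 < t" "t < Inf S" unfolding eq using dense by blast
    then have "\<not> has_large_cut TYPE('a) (1 / t)"
      using cInf_lower[OF _ bdd] by (subst cut) force+
    then show "\<exists>c. 0 < c \<and> c < 1 \<and> \<not> has_large_cut TYPE('a) c"
      using t by (intro exI[of _ "1 / t"]) simp
  next
    assume "\<exists>c. 0 < c \<and> c < 1 \<and> \<not> has_large_cut TYPE('a) c"
    then obtain c where c: "0 < c" "c < 1" "\<not> has_large_cut TYPE('a) c" by blast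
    then have "1 / c \<le> Inf S" using cut[of c] by (intro cInf_greatest[OF ne]) force
    moreover have "1 < 1 / c" using c by simp
    ultimately show "lattice_schaeffer_const TYPE('a) > 1" unfolding eq by linarith
  qed
qed

lemma one_minus_norm_diff_nonneg:
  fixes x y :: "'a::banach_lattice"
  assumes "0 \<le> y" "y \<le> x" "norm x \<le> 1"
  shows "0 \<le> 1 - norm (x - y)"
  using norm_mono_nonneg[of "x - y" x] assms by simp

lemma lower_modulus_mono_le:
  fixes x y :: "'a::banach_lattice"
  assumes "0 \<le> y" "y \<le> x" "norm x \<le> 1" "\<epsilon> \<le> norm y"
  shows "lower_modulus_mono TYPE('a) \<epsilon> \<le> 1 - norm (x - y)"
  unfolding lower_modulus_mono_def
proof (rule cInf_lower)
  show "bdd_below {1 - norm (x - y) | x y :: 'a. 0 \<le> y \<and> y \<le> x \<and> norm x \<le> 1 \<and> \<epsilon> \<le> norm y}"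
    using one_minus_norm_diff_nonneg by (intro bdd_belowI[of _ 0]) blast
qed (use assms in blast)

lemma
  assumes "\<exists>x :: 'a::banach_lattice. x \<noteq> 0" "\<epsilon> \<le> 1"
  shows lower_modulus_mono_nonneg: "0 \<le> lower_modulus_mono TYPE('a) \<epsilon>"
    and lower_modulus_mono_lessD: "lower_modulus_mono TYPE('a) \<epsilon> < t \<Longrightarrow>
      \<exists>x y :: 'a. 0 \<le> y \<and> y \<le> x \<and> norm x \<le> 1 \<and> \<epsilon> \<le> norm y \<and> 1 - norm (x - y) < t"
proof -
  let ?D = "{1 - norm (x - y) | x y :: 'a. 0 \<le> y \<and> y \<le> x \<and> norm x \<le> 1 \<and> \<epsilon> \<le> norm y}"
  obtain u :: 'a where "0 \<le> u" "norm u = 1"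
    using pos_sphere_nonempty[OF assms(1)] by (auto simp: pos_sphere_def)
  \<comment> \<open>The trivial cut \<open>u = u + 0\<close> is admissible for every \<open>\<epsilon> \<le> 1\<close>.\<close>
  then have "1 - norm (u - u) \<in> ?D" using assms(2) by fastforce
  then have ne: "?D \<noteq> {}" by blast
  show "0 \<le> lower_modulus_mono TYPE('a) \<epsilon>"
    unfolding lower_modulus_mono_def
    using one_minus_norm_diff_nonneg by (intro cInf_greatest[OF ne]) blast
  show "\<exists>x y :: 'a. 0 \<le> y \<and> y \<le> x \<and> norm x \<le> 1 \<and> \<epsilon> \<le> norm y \<and> 1 - norm (x - y) < t"
    if "lower_modulus_mono TYPE('a) \<epsilon> < t"
    using cInf_lessD[OF ne that[unfolded lower_modulus_mono_def]] by blast
qed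

lemma lower_modulus_mono_0:
  assumes "\<exists>x :: 'a::banach_lattice. x \<noteq> 0"
  shows "lower_modulus_mono TYPE('a) 0 = 0"
proof -
  obtain u :: 'a where "0 \<le> u" "norm u = 1"
    using pos_sphere_nonempty[OF assms] by (auto simp: pos_sphere_def)
  then have "lower_modulus_mono TYPE('a) 0 \<le> 0"
    using lower_modulus_mono_le[of 0 u 0] by simp
  then show ?thesis using lower_modulus_mono_nonneg[OF assms, of 0] by simp
qed

text \<open>The two parts of a cut enter the modulus asymmetrically: one is bounded below by \<open>\<epsilon>\<close>, the
  other is pushed towards norm one. Only cuts whose parts are both nearly of norm one matter for
  the question whether \<open>eps0_mono\<close> reaches \<open>1\<close>.\<close>

lemma eps0_mono_less_1_iff:
  assumes "\<exists>x :: 'a::banach_lattice. x \<noteq> 0"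
  shows "eps0_mono TYPE('a) < 1 \<longleftrightarrow> (\<exists>c. 0 < c \<and> c < 1 \<and> \<not> has_large_cut TYPE('a) c)"
proof -
  define E where "E = {\<epsilon>. 0 \<le> \<epsilon> \<and> \<epsilon> < 1 \<and> lower_modulus_mono TYPE('a) \<epsilon> = 0}"
  have eq: "eps0_mono TYPE('a) = Sup E" by (simp add: eps0_mono_def E_def)
  have zero: "0 \<in> E" using lower_modulus_mono_0[OF assms] by (simp add: E_def)
  have bdd: "bdd_above E" by (intro bdd_aboveI[of _ 1]) (auto simp: E_def)
  show ?thesis
  proof
    assume less: "eps0_mono TYPE('a) < 1"
    then obtain e where e: "Sup E < e" "e < 1" unfolding eq using dense by blast
    have "0 \<le> Sup E" using cSup_upper[OF zero bdd] .
    with e have "0 < e" by linarith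
    define d where "d = lower_modulus_mono TYPE('a) e"
    have "e \<notin> E" using cSup_upper[OF _ bdd, of e] e by auto
    then have "d \<noteq> 0" using e \<open>0 < e\<close> by (simp add: E_def d_def)
    then have "0 < d" using lower_modulus_mono_nonneg[OF assms, of e] e by (simp add: d_def)
    \<comment> \<open>A cut with one part of norm at least \<open>e\<close> leaves at most \<open>1 - d\<close> for the other part.\<close>
    define c where "c = max e (1 - d / 2)"
    have "\<not> has_large_cut TYPE('a) c"
    proof
      assume "has_large_cut TYPE('a) c"
      then obtain x y :: 'a
        where xy: "0 \<le> y" "y \<le> x" "norm x \<le> 1" "c \<le> norm y" "c \<le> norm (x - y)"
        unfolding has_large_cut_def by blast
      then have "d \<le> 1 - norm (x - y)"
        unfolding d_def by (intro lower_modulus_mono_le) (auto simp: c_def)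
      with xy(5) \<open>0 < d\<close> show False by (simp add: c_def)
    qed
    moreover have "0 < c" "c < 1" using e \<open>0 < e\<close> \<open>0 < d\<close> by (auto simp: c_def)
    ultimately show "\<exists>c. 0 < c \<and> c < 1 \<and> \<not> has_large_cut TYPE('a) c" by blast
  next
    assume "\<exists>c. 0 < c \<and> c < 1 \<and> \<not> has_large_cut TYPE('a) c"
    then obtain c where c: "0 < c" "c < 1" "\<not> has_large_cut TYPE('a) c" by blast
    have "\<epsilon> \<le> c" if "\<epsilon> \<in> E" for \<epsilon>
    proof (rule ccontr)
      assume "\<not> \<epsilon> \<le> c"
      have "lower_modulus_mono TYPE('a) \<epsilon> < 1 - c" "\<epsilon> \<le> 1"
        using that c by (auto simp: E_def)
      then obtain x y :: 'a
        where "0 \<le> y" "y \<le> x" "norm x \<le> 1" "\<epsilon> \<le> norm y" "1 - norm (x - y) < 1 - c"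
        using lower_modulus_mono_lessD[OF assms] by blast
      then have "has_large_cut TYPE('a) c"
        unfolding has_large_cut_def using \<open>\<not> \<epsilon> \<le> c\<close>
        by (intro exI[of _ x] exI[of _ y]) auto
      with c show False by simp
    qed
    then have "Sup E \<le> c" using zero by (intro cSup_least) auto
    then show "eps0_mono TYPE('a) < 1" using c unfolding eq by simp
  qed
qed

theorem proposition6p5:
  assumes "\<exists>x :: 'a::banach_lattice. x \<noteq> 0"
  shows "lattice_schaeffer_const TYPE('a) > 1 \<longleftrightarrow> eps0_mono TYPE('a) < 1"
  using schaeffer_const_gt_1_iff[OF assms] eps0_mono_less_1_iff[OF assms] by simp

end
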